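(* There is an algorithm which, given any instance $(C,S,p)$ of the balanced 2-period travelling salesman problem (balanced 2-TSP) in which the symmetric $n\times n$ distance matrix $C=(c_{ij})$ is a Kalmanson matrix, $S\subseteq\{1,\ldots,n\}$ is a set of nodes with $1\in S$ that must be visited in both periods, and $p\ge 0$ is an integer balance parameter, solves the instance to optimality in $O(n^3)$ time. That is, it finds a pair of tours of minimum total length $c(\tau^1)+c(\tau^2)$ among all feasible pairs $(\tau^1,\tau^2)$ for the instance $(C,S,p)$.
   Context: **Kalmanson matrix.** A symmetric real $n\times n$ matrix $C=(c_{ij})$ is a Kalmanson matrix if for all $1\le i<j<\ell<m\le n$ $$c_{ij}+c_{\ell m}\le c_{i\ell}+c_{jm}\qquad\text{and}\qquad c_{im}+c_{j\ell}\le c_{i\ell}+c_{jm}.$$ The conditions refer to the given numbering $1,\ldots,n$ of rows and columns. Diagonal entries do not appear in them. **Tours.** A tour on a node set $T\subseteq\{1,\ldots,n\}$ with $1\in T$ and $|T|=k$ is a cyclic sequence $\tau=\langle 1=\tau_1,\tau_2,\ldots,\tau_k,\tau_{k+1}=1\rangle$ in which $\tau_1,\ldots,\tau_k$ is an enumeration of $T$ without repetition. Its length is $c(\tau)=\sum_{i=1}^{k}c_{\tau_i,\tau_{i+1}}$. **Balanced 2-TSP.** An instance consists of a symmetric $n\times n$ distance matrix $C$, a subset $S\subseteq\{1,\ldots,n\}$ of fixed nodes (customers to be visited in both periods), where node $1$, the start and end location of both tours, belongs to $S$, and an integer $p\ge 0$. A feasible solution is a pair $(\tau^1,\tau^2)$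 of tours on node sets $T_1,T_2$ such that $T_1\cup T_2=\{1,\ldots,n\}$, $T_1\cap T_2=S$ (every fixed node appears in both tours and every other node appears in exactly one of them), and $\bigl||T_1|-|T_2|\bigr|\le p$. The objective is to minimize $c(\tau^1)+c(\tau^2)$ over all feasible solutions. If no feasible solution exists, solving the instance means reporting this. **Running time.** Time is measured in the usual unit-cost model: additions and comparisons of real numbers and elementary operations on integers and indices each count as one step. *)

theory Defs
  imports Complex_Main "HOL-Library.Landau_Symbols"
begin

section \<open>The balanced 2-period travelling salesman problem\<close>

text \<open>An n by n matrix is a function on indices; only its entries with both indices
  in \<open>{1..n}\<close> are ever constrained or read.\<close>

definition symmetric_matrix :: "nat \<Rightarrow> (nat \<Rightarrow> nat \<Rightarrow> real) \<Rightarrow> bool" where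
  "symmetric_matrix n C \<longleftrightarrow> (\<forall>i\<in>{1..n}. \<forall>j\<in>{1..n}. C i j = C j i)"

definition kalmanson :: "nat \<Rightarrow> (nat \<Rightarrow> nat \<Rightarrow> real) \<Rightarrow> bool" where
  "kalmanson n C \<longleftrightarrow> symmetric_matrix n C \<and>
     (\<forall>i j l m. 1 \<le> i \<and> i < j \<and> j < l \<and> l < m \<and> m \<le> n \<longrightarrow>
        C i j + C l m \<le> C i l + C j m \<and>
        C i m + C j l \<le> C i l + C j m)"

text \<open>The list holds the nodes of one round trip without the closing return to node 1.\<close>

definition is_tour :: "nat set \<Rightarrow> nat list \<Rightarrow> bool" where
  "is_tour T \<tau> \<longleftrightarrow> \<tau> \<noteq> [] \<and> hd \<tau> = 1 \<and> distinct \<tau> \<and> set \<tau> = T"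

text \<open>A tour visiting only node 1 has length \<open>C 1 1\<close>, as the general formula says.\<close>

definition tour_length :: "(nat \<Rightarrow> nat \<Rightarrow> real) \<Rightarrow> nat list \<Rightarrow> real" where
  "tour_length C \<tau> = (\<Sum>i<length \<tau>. C ((\<tau> @ [1]) ! i) ((\<tau> @ [1]) ! Suc i))"

definition feasible :: "nat \<Rightarrow> nat set \<Rightarrow> nat \<Rightarrow> nat list \<Rightarrow> nat list \<Rightarrow> bool" where
  "feasible n S p \<tau>1 \<tau>2 \<longleftrightarrow>
     (\<exists>T1 T2. is_tour T1 \<tau>1 \<and> is_tour T2 \<tau>2 \<and>
        T1 \<union> T2 = {1..n} \<and> T1 \<inter> T2 = S \<and>
        \<bar>int (card T1) - int (card T2)\<bar> \<le> int p)"

definition optimal ::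
  "nat \<Rightarrow> (nat \<Rightarrow> nat \<Rightarrow> real) \<Rightarrow> nat set \<Rightarrow> nat \<Rightarrow> nat list \<Rightarrow> nat list \<Rightarrow> bool" where
  "optimal n C S p \<tau>1 \<tau>2 \<longleftrightarrow> feasible n S p \<tau>1 \<tau>2 \<and>
     (\<forall>\<sigma>1 \<sigma>2. feasible n S p \<sigma>1 \<sigma>2 \<longrightarrow>
        tour_length C \<tau>1 + tour_length C \<tau>2 \<le> tour_length C \<sigma>1 + tour_length C \<sigma>2)"


section \<open>Algorithms in the unit-cost model\<close>

text \<open>Algorithms are programs of a small imperative language over integers and reals.
  All variables are arrays; the number of indices is the number of index expressions,
  so a scalar is an array accessed with the empty index list. Integer and real
  variables live in separate name spaces. Reals can only be copied, added and compared:
  there are no real constants, and reals cannot be converted to or from integers.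
  Integers can be added, subtracted and compared; multiplication and division are
  deliberately absent, which only makes running time bounds stronger.\<close>

datatype iexp =
    IConst int
  | IVar string "iexp list"
  | IAdd iexp iexp
  | ISub iexp iexp

datatype rexp =
    RVar string "iexp list"
  | RAdd rexp rexp

datatype bexp =
    ILess iexp iexp
  | RLess rexp rexp
  | BNot bexp
  | BAnd bexp bexp

datatype com =
    Skip
  | IAssign string "iexp list" iexp
  | RAssign string "iexp list" rexp
  | Seq com com
  | If bexp com com
  | While bexp com

record state =
  imem :: "string \<Rightarrow> int list \<Rightarrow> int"
  rmem :: "string \<Rightarrow> int list \<Rightarrow> real"

primrec ival :: "state \<Rightarrow> iexp \<Rightarrow> int" where
  "ival s (IConst k) = k"
| "ival s (IVar x es) = imem s x (map (ival s) es)"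
| "ival s (IAdd a b) = ival s a + ival s b"
| "ival s (ISub a b) = ival s a - ival s b"

primrec rval :: "state \<Rightarrow> rexp \<Rightarrow> real" where
  "rval s (RVar x es) = rmem s x (map (ival s) es)"
| "rval s (RAdd a b) = rval s a + rval s b"

primrec bval :: "state \<Rightarrow> bexp \<Rightarrow> bool" where
  "bval s (ILess a b) \<longleftrightarrow> ival s a < ival s b"
| "bval s (RLess a b) \<longleftrightarrow> rval s a < rval s b"
| "bval s (BNot b) \<longleftrightarrow> \<not> bval s b"
| "bval s (BAnd a b) \<longleftrightarrow> bval s a \<and> bval s b"

text \<open>The cost of an expression is the number of its operations, counting every
  constant, memory access, arithmetic operation, comparison and connective.\<close>

primrec icost :: "iexp \<Rightarrow> nat" where
  "icost (IConst k) = 1"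
| "icost (IVar x es) = 1 + sum_list (map icost es)"
| "icost (IAdd a b) = 1 + icost a + icost b"
| "icost (ISub a b) = 1 + icost a + icost b"

primrec rcost :: "rexp \<Rightarrow> nat" where
  "rcost (RVar x es) = 1 + sum_list (map icost es)"
| "rcost (RAdd a b) = 1 + rcost a + rcost b"

primrec bcost :: "bexp \<Rightarrow> nat" where
  "bcost (ILess a b) = 1 + icost a + icost b"
| "bcost (RLess a b) = 1 + rcost a + rcost b"
| "bcost (BNot b) = 1 + bcost b"
| "bcost (BAnd a b) = 1 + bcost a + bcost b"

definition iupd :: "string \<Rightarrow> int list \<Rightarrow> int \<Rightarrow> state \<Rightarrow> state" where
  "iupd x is v s = s\<lparr>imem := (imem s)(x := (imem s x)(is := v))\<rparr>"

definition rupd :: "string \<Rightarrow> int list \<Rightarrow> real \<Rightarrow> state \<Rightarrow> state" where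
  "rupd x is v s = s\<lparr>rmem := (rmem s)(x := (rmem s x)(is := v))\<rparr>"

text \<open>\<open>exec c s t s'\<close>: started in state \<open>s\<close>, the program \<open>c\<close> terminates in state \<open>s'\<close>
  after exactly \<open>t\<close> steps.\<close>

inductive exec :: "com \<Rightarrow> state \<Rightarrow> nat \<Rightarrow> state \<Rightarrow> bool" where
  Skip: "exec Skip s 1 s"
| IAssign: "exec (IAssign x es e) s (1 + sum_list (map icost es) + icost e)
     (iupd x (map (ival s) es) (ival s e) s)"
| RAssign: "exec (RAssign x es e) s (1 + sum_list (map icost es) + rcost e)
     (rupd x (map (ival s) es) (rval s e) s)"
| Seq: "exec c1 s t1 s' \<Longrightarrow> exec c2 s' t2 s'' \<Longrightarrow> exec (Seq c1 c2) s (t1 + t2) s''"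
| IfTrue: "bval s b \<Longrightarrow> exec c1 s t s' \<Longrightarrow> exec (If b c1 c2) s (1 + bcost b + t) s'"
| IfFalse: "\<not> bval s b \<Longrightarrow> exec c2 s t s' \<Longrightarrow> exec (If b c1 c2) s (1 + bcost b + t) s'"
| WhileFalse: "\<not> bval s b \<Longrightarrow> exec (While b c) s (1 + bcost b) s"
| WhileTrue: "bval s b \<Longrightarrow> exec c s t1 s' \<Longrightarrow> exec (While b c) s' t2 s'' \<Longrightarrow>
     exec (While b c) s (1 + bcost b + t1 + t2) s''"

inductive_cases Seq_E: "exec (Seq c1 c2) s t s'"
inductive_cases If_E: "exec (If b c1 c2) s t s'"
inductive_cases While_E: "exec (While b c) s t s'"

text \<open>Execution is deterministic, so the existence of a terminating run within a time
  bound is a statement about the only run.\<close>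

lemma exec_deterministic:
  "exec c s t s' \<Longrightarrow> exec c s u s'' \<Longrightarrow> t = u \<and> s' = s''"
proof (induction arbitrary: u s'' rule: exec.induct)
  case (Skip s)
  then show ?case by (cases rule: exec.cases) auto
next
  case (IAssign x es e s)
  then show ?case by (cases rule: exec.cases) auto
next
  case (RAssign x es e s)
  then show ?case by (cases rule: exec.cases) auto
next
  case (Seq c1 s t1 s' c2 t2 s3)
  from Seq.prems obtain u1 u2 r where u: "u = u1 + u2" and
    r: "exec c1 s u1 r" "exec c2 r u2 s''"
    by (rule Seq_E)
  have "t1 = u1 \<and> s' = r" using r(1) by (rule Seq.IH(1))
  moreover from this have "t2 = u2 \<and> s3 = s''" using r(2) Seq.IH(2)[of u2 s''] by simp
  ultimately show ?case using u by simp
next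
  case (IfTrue s b c1 t s' c2)
  from IfTrue.prems IfTrue.hyps(1) obtain v where u: "u = 1 + bcost b + v" and
    "exec c1 s v s''"
    by (auto elim: If_E)
  from IfTrue.IH[OF this(2)] u show ?case by simp
next
  case (IfFalse s b c2 t s' c1)
  from IfFalse.prems IfFalse.hyps(1) obtain v where u: "u = 1 + bcost b + v" and
    "exec c2 s v s''"
    by (auto elim: If_E)
  from IfFalse.IH[OF this(2)] u show ?case by simp
next
  case (WhileFalse s b c)
  from WhileFalse.prems WhileFalse.hyps show ?case by - (erule While_E, auto)
next
  case (WhileTrue s b c t1 s' t2 s3)
  from WhileTrue.prems WhileTrue.hyps(1) obtain u1 u2 r where
    u: "u = 1 + bcost b + u1 + u2" and
    r: "exec c s u1 r" "exec (While b c) r u2 s''"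
    by - (erule While_E, auto)
  have "t1 = u1 \<and> s' = r" using r(1) by (rule WhileTrue.IH(1))
  moreover from this have "t2 = u2 \<and> s3 = s''" using r(2) WhileTrue.IH(2)[of u2 s''] by simp
  ultimately show ?case using u by simp
qed


section \<open>Input and output of the algorithm\<close>

text \<open>The input consists of the integers \<open>n\<close> and \<open>p\<close>, the characteristic vector \<open>S[i]\<close> of
  the fixed nodes and the matrix entries \<open>C[i,j]\<close>. All other cells are 0.\<close>

definition input_state ::
  "nat \<Rightarrow> (nat \<Rightarrow> nat \<Rightarrow> real) \<Rightarrow> nat set \<Rightarrow> nat \<Rightarrow> state" where
  "input_state n C S p =
     \<lparr>imem = (\<lambda>x is.
        if x = ''n'' \<and> is = [] then int n
        else if x = ''p'' \<and> is = [] then int p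
        else if x = ''S'' \<and> (\<exists>i\<in>S. is = [int i]) then 1
        else 0),
      rmem = (\<lambda>x is.
        if x = ''C'' \<and> (\<exists>i\<in>{1..n}. \<exists>j\<in>{1..n}. is = [int i, int j])
        then C (nat (is ! 0)) (nat (is ! 1))
        else 0)\<rparr>"

text \<open>A tour is output as its number of nodes together with an array of nodes, indexed
  from 1. Negative values are read as 0, which is not a node.\<close>

definition output_list :: "state \<Rightarrow> string \<Rightarrow> string \<Rightarrow> nat list" where
  "output_list s len x =
     map (\<lambda>i. nat (imem s x [int i])) [1..<Suc (nat (imem s len []))]"

definition correct_output ::
  "nat \<Rightarrow> (nat \<Rightarrow> nat \<Rightarrow> real) \<Rightarrow> nat set \<Rightarrow> nat \<Rightarrow> state \<Rightarrow> bool" where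
  "correct_output n C S p s \<longleftrightarrow>
     (if \<exists>\<tau>1 \<tau>2. feasible n S p \<tau>1 \<tau>2
      then imem s ''found'' [] = 1 \<and>
        optimal n C S p (output_list s ''len1'' ''tour1'') (output_list s ''len2'' ''tour2'')
      else imem s ''found'' [] = 0)"

end

(* In a Kalmanson matrix a largest node is inserted most cheaply between the previous largest node
   and node 1, so for every node set the tour in increasing order is optimal. Adding the nodes
   1, ..., n in this order to one or both tours, the cost of what remains depends only on the
   current end nodes a, b and the difference d of the tour sizes, the last node added being
   max a b. This gives O(n^3) states with at most two successors each; their values are computed
   backwards, and the optimal tours are then read off forwards. *)

theory Submission
  imports Defs
begin

section \<open>Sorted tours are optimal\<close>

text \<open>Optimality is proved from two sides that never meet in one equation.
  \<open>completion\<close> is only shown to lie below the cost of every feasible pair; that it is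
  attained follows from the forward phase, which keeps path lengths plus remaining completion
  constant. The table covers all end nodes \<open>a\<close>, \<open>b\<close>, reachable or not, and
  all differences with |d| \<le> max a b. This cone is closed under adding a node, since
  \<open>d\<close> changes by at most 1 while the maximum grows by 1. A successor enlarges
  \<open>a\<close> or \<open>b\<close> and never decreases the other, so running both downwards
  meets every successor first, whatever the order in \<open>d\<close>. The language has no real
  constants, hence no infinity: infeasibility is an integer flag beside the value. No decisions are
  stored; the forward phase repeats the comparisons. Running time is read off the program text as a
  constant times a power of \<open>n\<close> given by the loop depth, so only iteration counts need
  an argument about states.\<close>

fun path_length :: "('a \<Rightarrow> 'a \<Rightarrow> real) \<Rightarrow> 'a list \<Rightarrow> real" where
  "path_length C (x # y # zs) = C x y + path_length C (y # zs)"
| "path_length C _ = 0"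

lemma path_length_append:
  "path_length C (xs @ x # ys) = path_length C (xs @ [x]) + path_length C (x # ys)"
  by (induction C xs rule: path_length.induct) simp_all

lemma path_length_snoc:
  "xs \<noteq> [] \<Longrightarrow> path_length C (xs @ [y]) = path_length C xs + C (last xs) y"
  by (induction C xs rule: path_length.induct) auto

lemma path_length_eq_sum:
  "path_length C xs = (\<Sum>i<length xs - 1. C (xs ! i) (xs ! Suc i))"
  by (induction C xs rule: path_length.induct) (simp_all add: sum.lessThan_Suc_shift del: sum.lessThan_Suc)

lemma tour_length_eq_path_length: "tour_length C \<tau> = path_length C (\<tau> @ [1])"
  by (simp add: tour_length_def path_length_eq_sum)

lemma one_in_tour: "is_tour T \<tau> \<Longrightarrow> 1 \<in> T"
  unfolding is_tour_def by (metis hd_in_set)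

section \<open>Cheapest insertion of a largest node\<close>

lemma kalmanson_sym:
  "kalmanson n C \<Longrightarrow> i \<in> {1..n} \<Longrightarrow> j \<in> {1..n} \<Longrightarrow> C i j = C j i"
  by (auto simp: kalmanson_def symmetric_matrix_def)

text \<open>Sum of the first Kalmanson inequality for \<open>x, y, m, l\<close> and the second for
  \<open>1, x, m, l\<close>; the entry \<open>C x m\<close> cancels. They degenerate to equalities
  when \<open>y = m\<close> and \<open>x = 1\<close>, respectively.\<close>

lemma kalmanson_insertion_less:
  assumes K: "kalmanson n C" and "1 \<le> x" "x < y" "y \<le> m" "m < l" "l \<le> n"
  shows "C m l + C 1 l + C x y \<le> C x l + C y l + C 1 m"
proof -
  have "C x y + C m l \<le> C x m + C y l"
    using assms by (cases "y = m") (auto simp: kalmanson_def)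
  moreover have "C 1 l + C x m \<le> C 1 m + C x l"
    using assms by (cases "x = 1") (auto simp: kalmanson_def)
  ultimately show ?thesis by linarith
qed

text \<open>An arbitrary tour may pass the neighbours of \<open>l\<close> in either order; symmetry
  of \<open>C\<close> reduces \<open>y < x\<close> to \<open>x < y\<close>.\<close>

lemma kalmanson_insertion:
  assumes K: "kalmanson n C" and "1 \<le> x" "1 \<le> y" "x \<noteq> y" "x \<le> m" "y \<le> m" "m < l" "l \<le> n"
  shows "C m l + C l 1 - C m 1 \<le> C x l + C l y - C x y"
proof -
  have sym: "C l 1 = C 1 l" "C m 1 = C 1 m" "C l y = C y l" "C x y = C y x"
    using assms by (auto intro!: kalmanson_sym[OF K])
  show ?thesis
  proof (cases "x < y")
    case True
    then show ?thesis using kalmanson_insertion_less[OF K, of x y m l] assms sym by linarith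
  next
    case False
    then show ?thesis using kalmanson_insertion_less[OF K, of y x m l] assms sym by linarith
  qed
qed

lemma path_length_insert:
  "path_length C (us @ x # l # y # vs) =
     path_length C (us @ x # y # vs) + (C x l + C l y - C x y)"
  using path_length_append[of C us x "l # y # vs"] path_length_append[of C us x "y # vs"] by simp

text \<open>Removing the largest node from any tour saves at least what it costs to append that node
  to the sorted tour of the others. The matrix size \<open>N\<close> stays fixed, so the induction
  on the node bound \<open>n\<close> keeps the Kalmanson hypothesis.\<close>

lemma sorted_tour_optimal:
  assumes K: "kalmanson N C" and "n \<le> N" "is_tour (set \<tau>) \<tau>" "set \<tau> \<subseteq> {1..n}"
  shows "path_length C (filter (\<lambda>i. i \<in> set \<tau>) [1..<Suc n] @ [1]) \<le> path_length C (\<tau> @ [1])"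
  using assms(2-)
proof (induction n arbitrary: \<tau>)
  case 0
  then show ?case by (auto simp: is_tour_def)
next
  case (Suc n)
  let ?s = "\<lambda>\<tau>. filter (\<lambda>i. i \<in> set \<tau>) [1..<Suc n]"
  have \<tau>: "\<tau> \<noteq> []" "hd \<tau> = 1" "distinct \<tau>" using Suc.prems by (auto simp: is_tour_def)
  show ?case
  proof (cases "Suc n \<in> set \<tau>")
    case False
    with Suc.prems(3) have "set \<tau> \<subseteq> {1..n}" by (force simp: le_Suc_eq)
    with Suc False show ?thesis by simp
  next
    case in\<tau>: True
    show ?thesis
    proof (cases "n = 0")
      case True
      with Suc.prems(3) have "set \<tau> \<subseteq> {1}" by auto
      with \<tau> have "\<tau> = [1]" by (cases \<tau>; cases "tl \<tau>") auto
      then show ?thesis using True by simp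
    next
      case n: False
      obtain us vs where uv: "\<tau> = us @ Suc n # vs" using in\<tau> by (meson split_list)
      have us: "us \<noteq> []" "hd us = 1" using \<tau> uv n by (cases us; auto)+
      let ?t = "us @ vs"
      have set: "set ?t = set \<tau> - {Suc n}" using \<tau>(3) uv by auto
      have tour: "is_tour (set ?t) ?t" using \<tau> us uv by (auto simp: is_tour_def)
      have sub: "set ?t \<subseteq> {1..n}" unfolding set using Suc.prems(3) atLeastAtMostSuc_conv[of 1 n] by auto
      have IH: "path_length C (?s ?t @ [1]) \<le> path_length C (?t @ [1])"
        using Suc.IH[OF _ tour sub] Suc.prems(1) by simp
      have s: "filter (\<lambda>i. i \<in> set \<tau>) [1..<Suc (Suc n)] = ?s ?t @ [Suc n]"
      proof -
        have "filter (\<lambda>i. i \<in> set \<tau>) [1..<Suc n] = ?s ?t"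
          unfolding set by (rule filter_cong) auto
        then show ?thesis using in\<tau> by simp
      qed
      obtain us' x where x: "us = us' @ [x]" using us(1) by (cases us rule: rev_cases) auto
      \<comment> \<open>The closing return to node 1 supplies a successor even when
        \<open>Suc n\<close> is the last node of the tour.\<close>
      obtain y vs' where y: "vs @ [1] = y # vs'" by (cases vs) auto
      have "1 \<in> set us" using us by (metis hd_in_set)
      obtain f where f: "f = ?s ?t" by blast
      have setf: "set f = set ?t" using sub unfolding f by (auto simp del: upt_Suc)
      have "sorted f" by (simp add: f sorted_wrt_filter del: upt_Suc)
      have "f \<noteq> []" using setf us by auto
      then obtain ss m where m: "f = ss @ [m]" by (metis append_butlast_last_id)
      have mt: "m \<in> set ?t" using setf m by auto
      have mn: "m \<le> n" using mt sub by force
      have max: "i \<le> m" if "i \<in> set ?t" for i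
        using that \<open>sorted f\<close> unfolding setf[symmetric] m by (auto simp: sorted_append)
      have xs: "x \<in> set ?t" using x by simp
      have ys: "y \<in> set ?t" using y \<open>1 \<in> set us\<close> by (cases vs) auto
      have ins: "path_length C (\<tau> @ [1]) = path_length C (?t @ [1]) + (C x (Suc n) + C (Suc n) y - C x y)"
        using path_length_insert[of C us' x "Suc n" y vs'] by (simp add: uv x y del: One_nat_def)
      have ins': "path_length C (f @ [Suc n] @ [1]) =
          path_length C (f @ [1]) + (C m (Suc n) + C (Suc n) 1 - C m 1)"
        using path_length_insert[of C ss m "Suc n" 1 "[]"] by (simp add: m)
      have "C m (Suc n) + C (Suc n) 1 - C m 1 \<le> C x (Suc n) + C (Suc n) y - C x y"
      proof (cases "x = y")
        case False
        then show ?thesis using kalmanson_insertion[OF K, of x y m "Suc n"] max[OF xs] max[OF ys]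
            mn subsetD[OF sub xs] subsetD[OF sub ys] Suc.prems(1) by auto
      next
        case True
        \<comment> \<open>Equal neighbours occur only in the tour \<open>[1, Suc n]\<close>. Its
          removal leaves the diagonal entry \<open>C 1 1\<close>, about which the Kalmanson
          conditions say nothing, but here both insertion costs coincide.\<close>
        have "vs = []"
        proof (rule ccontr)
          assume "vs \<noteq> []"
          then have "y \<in> set vs" using y by (cases vs) auto
          then show False using True \<tau>(3) uv x by auto
        qed
        then have "x = 1" using y True by simp
        then have "us' = []" using us x \<tau>(3) uv by (cases us') auto
        then have "?t = [1]" using x \<open>vs = []\<close> \<open>x = 1\<close> by simp
        then have "m = 1" using mt by simp
        then show ?thesis using True \<open>x = 1\<close> by simp
      qed
      then show ?thesis using IH ins ins' unfolding s f append_assoc by linarith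
    qed
  qed
qed


section \<open>The dynamic program\<close>

text \<open>\<open>None\<close> acts as infinity. Ties go to the first alternative, which matches
  the negated strict comparison in the program.\<close>

definition prefers_first :: "real option \<Rightarrow> real option \<Rightarrow> bool" where
  "prefers_first u v \<longleftrightarrow> (\<exists>x. u = Some x \<and> (\<forall>y. v = Some y \<longrightarrow> x \<le> y))"

text \<open>Least total length of two paths that start in \<open>a\<close> and \<open>b\<close>, run in this order through the
  nodes of the list, and end in node 1, where \<open>\<delta>\<close> is the difference of the sizes of the two tours
  before these nodes are added; \<open>None\<close> stands for infeasibility.\<close>

fun completion ::
  "(nat \<Rightarrow> nat \<Rightarrow> real) \<Rightarrow> nat set \<Rightarrow> nat \<Rightarrow> nat list \<Rightarrow> nat \<Rightarrow> nat \<Rightarrow> int \<Rightarrow> real option" where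
  "completion C S p [] a b \<delta> = (if \<bar>\<delta>\<bar> \<le> int p then Some (C a 1 + C b 1) else None)"
| "completion C S p (x # xs) a b \<delta> =
    (if x \<in> S then map_option ((+) (C a x + C b x)) (completion C S p xs x x \<delta>)
     else let u = map_option ((+) (C a x)) (completion C S p xs x b (\<delta> + 1));
              v = map_option ((+) (C b x)) (completion C S p xs a x (\<delta> - 1))
          in if prefers_first u v then u else v)"

text \<open>A distribution of the remaining nodes to \<open>A\<close> and \<open>B\<close>
  prescribes one branch at every node, and the recursion never takes a dearer one. In particular a
  balanced distribution rules out \<open>None\<close>.\<close>

lemma completion_le:
  assumes "\<forall>i\<in>set xs. (i \<in> A \<or> i \<in> B) \<and> (i \<in> A \<and> i \<in> B \<longleftrightarrow> i \<in> S)"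
    and "\<bar>\<delta> + int (length (filter (\<lambda>i. i \<in> A) xs)) - int (length (filter (\<lambda>i. i \<in> B) xs))\<bar> \<le> int p"
  shows "\<exists>v. completion C S p xs a b \<delta> = Some v \<and>
    v \<le> path_length C (a # filter (\<lambda>i. i \<in> A) xs @ [1]) + path_length C (b # filter (\<lambda>i. i \<in> B) xs @ [1])"
  using assms
proof (induction xs arbitrary: a b \<delta>)
  case Nil
  then show ?case by simp
next
  case (Cons x xs)
  consider "x \<in> A" "x \<in> B" "x \<in> S" | "x \<in> A" "x \<notin> B" "x \<notin> S" | "x \<notin> A" "x \<in> B" "x \<notin> S"
    using Cons.prems(1) by auto
  then show ?case
  proof cases
    case 1
    then show ?thesis using Cons.IH[of \<delta> x x] Cons.prems by (auto simp: algebra_simps)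
  next
    case 2
    then show ?thesis using Cons.IH[of "\<delta> + 1" x b] Cons.prems
      by (auto simp: prefers_first_def algebra_simps)
  next
    case 3
    then show ?thesis using Cons.IH[of "\<delta> - 1" a x] Cons.prems
      by (auto simp: prefers_first_def algebra_simps)
  qed
qed

text \<open>Sorting both tours keeps their node sets and lengthens neither, and sorted tours are
  what the recursion ranges over. Read contrapositively, the value \<open>None\<close> certifies
  that the instance is infeasible.\<close>

lemma feasible_completion:
  assumes K: "kalmanson n C" and f: "feasible n S p \<sigma>1 \<sigma>2"
  shows "\<exists>v. completion C S p [2..<Suc n] 1 1 0 = Some v \<and> v \<le> tour_length C \<sigma>1 + tour_length C \<sigma>2"
proof -
  obtain A B where AB: "is_tour A \<sigma>1" "is_tour B \<sigma>2" "A \<union> B = {1..n}" "A \<inter> B = S"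
    "\<bar>int (card A) - int (card B)\<bar> \<le> int p"
    using f by (auto simp: feasible_def)
  have n: "1 \<le> n" using one_in_tour[OF AB(1)] AB(3) by force
  let ?f = "\<lambda>T. filter (\<lambda>i. i \<in> T) [2..<Suc n]"
  have eq: "filter (\<lambda>i. i \<in> T) [1..<Suc n] = 1 # ?f T"
    \<comment> \<open>Node 1 is stripped from both tours, so the two \<open>Suc\<close> cancel in
      the size difference and the recursion may start from 0.\<close>
    and card: "card T = Suc (length (?f T))"
    and le: "path_length C (1 # ?f T @ [1]) \<le> tour_length C \<sigma>"
    if T: "is_tour T \<sigma>" "T \<subseteq> {1..n}" for T \<sigma>
  proof -
    have 1: "1 \<in> T" using T(1) by (rule one_in_tour)
    show eq: "filter (\<lambda>i. i \<in> T) [1..<Suc n] = 1 # ?f T"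
      using n 1 by (subst upt_conv_Cons) (auto simp: numeral_2_eq_2)
    have "T = set (filter (\<lambda>i. i \<in> T) [1..<Suc n])" using T(2) by auto
    then have "card T = length (filter (\<lambda>i. i \<in> T) [1..<Suc n])"
      by (metis distinct_card distinct_filter distinct_upt)
    then show "card T = Suc (length (?f T))" by (simp only: eq) simp
    show "path_length C (1 # ?f T @ [1]) \<le> tour_length C \<sigma>"
      using sorted_tour_optimal[OF K order.refl, of \<sigma>] T eq
      by (simp add: is_tour_def tour_length_eq_path_length del: upt_Suc)
  qed
  have sub: "A \<subseteq> {1..n}" "B \<subseteq> {1..n}" using AB(3) by auto
  have "\<exists>v. completion C S p [2..<Suc n] 1 1 0 = Some v \<and>
      v \<le> path_length C (1 # ?f A @ [1]) + path_length C (1 # ?f B @ [1])"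
  proof (rule completion_le)
    show "\<forall>i\<in>set [2..<Suc n]. (i \<in> A \<or> i \<in> B) \<and> (i \<in> A \<and> i \<in> B \<longleftrightarrow> i \<in> S)"
      using AB(3,4) by (auto simp del: upt_Suc)
    show "\<bar>0 + int (length (?f A)) - int (length (?f B))\<bar> \<le> int p"
      using AB(5) card[OF AB(1) sub(1)] card[OF AB(2) sub(2)] by simp
  qed
  then show ?thesis using le[OF AB(1) sub(1)] le[OF AB(2) sub(2)] by force
qed

section \<open>Partial tours that extend to an optimal pair\<close>

text \<open>The invariant of the forward phase, with \<open>v\<close> the optimal value.\<close>

definition extends_to ::
  "(nat \<Rightarrow> nat \<Rightarrow> real) \<Rightarrow> nat set \<Rightarrow> nat \<Rightarrow> nat \<Rightarrow> real \<Rightarrow> nat \<Rightarrow> nat \<Rightarrow> nat \<Rightarrow> int \<Rightarrow>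
    nat list \<Rightarrow> nat list \<Rightarrow> bool" where
  "extends_to C S p n v k a b \<delta> \<pi>1 \<pi>2 \<longleftrightarrow>
     is_tour (set \<pi>1) \<pi>1 \<and> is_tour (set \<pi>2) \<pi>2 \<and> last \<pi>1 = a \<and> last \<pi>2 = b \<and>
     set \<pi>1 \<union> set \<pi>2 = {1..k} \<and> set \<pi>1 \<inter> set \<pi>2 = S \<inter> {1..k} \<and> max a b = k \<and>
     \<delta> = int (length \<pi>1) - int (length \<pi>2) \<and>
     (\<exists>w. completion C S p [Suc k..<Suc n] a b \<delta> = Some w \<and>
        path_length C \<pi>1 + path_length C \<pi>2 + w = v)"

lemma extends_to_init:
  "completion C S p [2..<Suc n] 1 1 0 = Some v \<Longrightarrow> 1 \<in> S \<Longrightarrow> extends_to C S p n v 1 1 1 0 [1] [1]"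
  by (auto simp: extends_to_def is_tour_def numeral_2_eq_2)

text \<open>Both tours list distinct nodes of \<open>{1..k}\<close>, so their sizes differ by at
  most \<open>k\<close>. This places the current state, and hence its successors, inside the
  table.\<close>

lemma extends_to_bounds:
  assumes "extends_to C S p n v k a b \<delta> \<pi>1 \<pi>2"
  shows "1 \<le> a" "1 \<le> b" "k = max a b" "\<bar>\<delta>\<bar> \<le> int k"
proof -
  note e = assms[unfolded extends_to_def is_tour_def]
  have "a \<in> set \<pi>1" "b \<in> set \<pi>2" using e last_in_set by blast+
  then show "1 \<le> a" "1 \<le> b" using e by force+
  show "k = max a b" using e by simp
  have "length \<pi>1 = card (set \<pi>1)" "length \<pi>2 = card (set \<pi>2)" using e by (simp_all add: distinct_card)
  moreover have "card (set \<pi>1) \<le> card {1..k}" "card (set \<pi>2) \<le> card {1..k}"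
    using e by (intro card_mono; blast)+
  ultimately show "\<bar>\<delta>\<bar> \<le> int k" using e by simp
qed

lemma is_tour_snoc:
  "is_tour (set \<pi>) \<pi> \<Longrightarrow> x \<notin> set \<pi> \<Longrightarrow> is_tour (set (\<pi> @ [x])) (\<pi> @ [x])"
  by (auto simp: is_tour_def)

text \<open>The step follows the branch that defines the current completion value, so the cost of
  the new edges merely moves from the completion to the path lengths and \<open>v\<close> is
  unchanged. The chosen branch cannot be \<open>None\<close> because the current value is
  not.\<close>

lemma extends_to_step:
  assumes e: "extends_to C S p n v k a b \<delta> \<pi>1 \<pi>2" and k: "k < n"
  shows "Suc k \<in> S \<Longrightarrow>
      extends_to C S p n v (Suc k) (Suc k) (Suc k) \<delta> (\<pi>1 @ [Suc k]) (\<pi>2 @ [Suc k])"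
    and "\<lbrakk>Suc k \<notin> S;
      prefers_first
        (map_option ((+) (C a (Suc k))) (completion C S p [Suc (Suc k)..<Suc n] (Suc k) b (\<delta> + 1)))
        (map_option ((+) (C b (Suc k))) (completion C S p [Suc (Suc k)..<Suc n] a (Suc k) (\<delta> - 1)))\<rbrakk> \<Longrightarrow>
      extends_to C S p n v (Suc k) (Suc k) b (\<delta> + 1) (\<pi>1 @ [Suc k]) \<pi>2"
    and "\<lbrakk>Suc k \<notin> S;
      \<not> prefers_first
        (map_option ((+) (C a (Suc k))) (completion C S p [Suc (Suc k)..<Suc n] (Suc k) b (\<delta> + 1)))
        (map_option ((+) (C b (Suc k))) (completion C S p [Suc (Suc k)..<Suc n] a (Suc k) (\<delta> - 1)))\<rbrakk> \<Longrightarrow>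
      extends_to C S p n v (Suc k) a (Suc k) (\<delta> - 1) \<pi>1 (\<pi>2 @ [Suc k])"
proof -
  note E = e[unfolded extends_to_def]
  have upt: "[Suc k..<Suc n] = Suc k # [Suc (Suc k)..<Suc n]" using k by (simp add: upt_conv_Cons del: upt_Suc)
  have notin: "Suc k \<notin> set \<pi>1" "Suc k \<notin> set \<pi>2"
  proof -
    have "set \<pi>1 \<subseteq> {1..k}" "set \<pi>2 \<subseteq> {1..k}" using E by blast+
    then show "Suc k \<notin> set \<pi>1" "Suc k \<notin> set \<pi>2" by auto
  qed
  have ne: "\<pi>1 \<noteq> []" "\<pi>2 \<noteq> []" using E by (auto simp: is_tour_def)
  have ab: "a \<le> k" "b \<le> k" using E by auto
  have ivl: "{1..Suc k} = insert (Suc k) {1..k}" by auto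
  have tour: "is_tour (set (\<pi>1 @ [Suc k])) (\<pi>1 @ [Suc k])" "is_tour (set (\<pi>2 @ [Suc k])) (\<pi>2 @ [Suc k])"
    using E notin by (blast intro: is_tour_snoc)+
  have len: "path_length C (\<pi>1 @ [Suc k]) = path_length C \<pi>1 + C a (Suc k)"
    "path_length C (\<pi>2 @ [Suc k]) = path_length C \<pi>2 + C b (Suc k)"
    using E ne by (simp_all add: path_length_snoc)
  {
    assume "Suc k \<in> S"
    then show "extends_to C S p n v (Suc k) (Suc k) (Suc k) \<delta> (\<pi>1 @ [Suc k]) (\<pi>2 @ [Suc k])"
      using E tour notin unfolding extends_to_def upt ivl len
      by (auto simp del: upt_Suc)
  next
    assume "Suc k \<notin> S" and "prefers_first
        (map_option ((+) (C a (Suc k))) (completion C S p [Suc (Suc k)..<Suc n] (Suc k) b (\<delta> + 1)))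
        (map_option ((+) (C b (Suc k))) (completion C S p [Suc (Suc k)..<Suc n] a (Suc k) (\<delta> - 1)))"
    then show "extends_to C S p n v (Suc k) (Suc k) b (\<delta> + 1) (\<pi>1 @ [Suc k]) \<pi>2"
      using E tour notin ab unfolding extends_to_def upt ivl len
      by (auto simp del: upt_Suc)
  next
    assume "Suc k \<notin> S" and "\<not> prefers_first
        (map_option ((+) (C a (Suc k))) (completion C S p [Suc (Suc k)..<Suc n] (Suc k) b (\<delta> + 1)))
        (map_option ((+) (C b (Suc k))) (completion C S p [Suc (Suc k)..<Suc n] a (Suc k) (\<delta> - 1)))"
    then show "extends_to C S p n v (Suc k) a (Suc k) (\<delta> - 1) \<pi>1 (\<pi>2 @ [Suc k])"
      using E tour notin ab unfolding extends_to_def upt ivl len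
      by (auto simp del: upt_Suc)
  }
qed

text \<open>With no node left, the completion consists of the two closing edges, and its being
  defined is the balance condition.\<close>

lemma extends_to_final:
  assumes e: "extends_to C S p n v n a b \<delta> \<pi>1 \<pi>2" and "S \<subseteq> {1..n}"
  shows "feasible n S p \<pi>1 \<pi>2" "tour_length C \<pi>1 + tour_length C \<pi>2 = v"
proof -
  note E = e[unfolded extends_to_def]
  have *: "\<bar>\<delta>\<bar> \<le> int p" "path_length C \<pi>1 + path_length C \<pi>2 + (C a 1 + C b 1) = v"
    using E by (auto split: if_splits)
  have "length \<pi>1 = card (set \<pi>1)" "length \<pi>2 = card (set \<pi>2)" using E by (simp_all add: is_tour_def distinct_card)
  then show "feasible n S p \<pi>1 \<pi>2" using E * assms(2) unfolding feasible_def
    by (intro exI[of _ "set \<pi>1"] exI[of _ "set \<pi>2"]) auto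
  show "tour_length C \<pi>1 + tour_length C \<pi>2 = v"
    using E * by (simp add: tour_length_eq_path_length path_length_snoc is_tour_def)
qed

section \<open>Running times of programs with short loops\<close>

primrec loop_depth :: "com \<Rightarrow> nat" where
  "loop_depth Skip = 0"
| "loop_depth (IAssign x es e) = 0"
| "loop_depth (RAssign x es e) = 0"
| "loop_depth (Seq c1 c2) = max (loop_depth c1) (loop_depth c2)"
| "loop_depth (If b c1 c2) = max (loop_depth c1) (loop_depth c2)"
| "loop_depth (While b c) = Suc (loop_depth c)"

text \<open>If every loop is iterated at most \<open>3 * n\<close> times, the running time of \<open>c\<close> is at most
  \<open>time_factor c * n ^ loop_depth c\<close>; the innermost loop of the program below has up to
  \<open>2 * n + 1\<close> iterations.\<close>

primrec time_factor :: "com \<Rightarrow> nat" where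
  "time_factor Skip = 1"
| "time_factor (IAssign x es e) = 1 + sum_list (map icost es) + icost e"
| "time_factor (RAssign x es e) = 1 + sum_list (map icost es) + rcost e"
| "time_factor (Seq c1 c2) = time_factor c1 + time_factor c2"
| "time_factor (If b c1 c2) = 1 + bcost b + time_factor c1 + time_factor c2"
| "time_factor (While b c) = (1 + bcost b + time_factor c) * 3 + 1 + bcost b"

text \<open>Termination, time bound and postcondition in one predicate. The bound depends on the
  program and \<open>n\<close> but not on the state, so it serves uniformly for all iterations of a
  loop body.\<close>

definition timed :: "nat \<Rightarrow> com \<Rightarrow> state \<Rightarrow> (state \<Rightarrow> bool) \<Rightarrow> bool" where
  "timed n c s Q \<longleftrightarrow> (\<exists>t s'. exec c s t s' \<and> t \<le> time_factor c * n ^ loop_depth c \<and> Q s')"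

lemma timed_mono: "timed n c s Q \<Longrightarrow> (\<And>s'. Q s' \<Longrightarrow> R s') \<Longrightarrow> timed n c s R"
  by (auto simp: timed_def)

lemma scale_power_mono:
  "t \<le> a * n ^ i \<Longrightarrow> i \<le> j \<Longrightarrow> 1 \<le> n \<Longrightarrow> t \<le> a * (n::nat) ^ j"
  by (meson le_trans mult_le_mono2 power_increasing)

text \<open>The postcondition of \<open>c1\<close> is itself a \<open>timed\<close> statement about
  \<open>c2\<close>, as in a weakest precondition, so no intermediate assertion has to be
  supplied.\<close>

lemma timed_Seq:
  assumes n: "1 \<le> n" and c1: "timed n c1 s (\<lambda>s'. timed n c2 s' Q)"
  shows "timed n (Seq c1 c2) s Q"
proof -
  obtain t1 s1 where 1: "exec c1 s t1 s1" "t1 \<le> time_factor c1 * n ^ loop_depth c1" "timed n c2 s1 Q"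
    using c1 by (auto simp: timed_def)
  obtain t2 s2 where 2: "exec c2 s1 t2 s2" "t2 \<le> time_factor c2 * n ^ loop_depth c2" "Q s2"
    using 1(3) by (auto simp: timed_def)
  let ?j = "loop_depth (Seq c1 c2)"
  have "t1 \<le> time_factor c1 * n ^ ?j" "t2 \<le> time_factor c2 * n ^ ?j"
    using scale_power_mono[OF 1(2) _ n, of ?j] scale_power_mono[OF 2(2) _ n, of ?j] by simp_all
  then have "t1 + t2 \<le> time_factor (Seq c1 c2) * n ^ ?j"
    by (simp add: add_mult_distrib)
  then show ?thesis using exec.Seq[OF 1(1) 2(1)] 2(3) unfolding timed_def by blast
qed

lemma timed_If:
  assumes n: "1 \<le> n" and "bval s b \<Longrightarrow> timed n c1 s Q" "\<not> bval s b \<Longrightarrow> timed n c2 s Q"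
  shows "timed n (If b c1 c2) s Q"
proof -
  let ?j = "loop_depth (If b c1 c2)"
  have pos: "1 \<le> n ^ ?j" using n by simp
  have bound: "1 + bcost b + t \<le> time_factor (If b c1 c2) * n ^ ?j"
    if "t \<le> a * n ^ i" "i \<le> ?j" "a \<le> time_factor c1 + time_factor c2" for t a i
  proof -
    have "t \<le> a * n ^ ?j" using scale_power_mono[OF that(1,2) n] .
    also have "\<dots> \<le> (time_factor c1 + time_factor c2) * n ^ ?j" using that(3) by (rule mult_le_mono1)
    moreover have "1 + bcost b \<le> (1 + bcost b) * n ^ ?j" using mult_le_mono2[OF pos, of "1 + bcost b"] by simp
    ultimately show ?thesis by (simp add: add_mult_distrib)
  qed
  show ?thesis
  proof (cases "bval s b")
    case True
    then obtain t s' where t: "exec c1 s t s'" "t \<le> time_factor c1 * n ^ loop_depth c1" "Q s'"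
      using assms(2) by (auto simp: timed_def)
    then show ?thesis using exec.IfTrue[OF True t(1), of c2] bound[OF t(2)] unfolding timed_def by auto
  next
    case False
    then obtain t s' where t: "exec c2 s t s'" "t \<le> time_factor c2 * n ^ loop_depth c2" "Q s'"
      using assms(3) by (auto simp: timed_def)
    then show ?thesis using exec.IfFalse[OF False t(1), of c1] bound[OF t(2)] unfolding timed_def by auto
  qed
qed

text \<open>The measure \<open>\<mu>\<close> drops in each iteration, so its initial value bounds
  their number. The last, failing test contributes the extra \<open>1 + bcost b\<close>.\<close>

lemma timed_While:
  fixes \<mu> :: "state \<Rightarrow> nat"
  assumes n: "1 \<le> n" and inv: "I s" and short: "\<mu> s \<le> 3 * n"
    and body: "\<And>s. I s \<Longrightarrow> bval s b \<Longrightarrow> timed n c s (\<lambda>s'. I s' \<and> \<mu> s' < \<mu> s)"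
    and exit: "\<And>s. I s \<Longrightarrow> \<not> bval s b \<Longrightarrow> Q s"
  shows "timed n (While b c) s Q"
proof -
  let ?B = "time_factor c * n ^ loop_depth c"
  have "\<exists>t s'. exec (While b c) s t s' \<and> t \<le> (1 + bcost b + ?B) * \<mu> s + (1 + bcost b) \<and> Q s'"
    using inv
  proof (induction "\<mu> s" arbitrary: s rule: less_induct)
    case less
    show ?case
    proof (cases "bval s b")
      case False
      then show ?thesis using exec.WhileFalse[OF False] exit[OF less.prems False]
        by (meson le_add2)
    next
      case True
      obtain t1 s1 where 1: "exec c s t1 s1" "t1 \<le> ?B" "I s1" "\<mu> s1 < \<mu> s"
        using body[OF less.prems True] by (auto simp: timed_def)
      obtain t2 s2 where 2: "exec (While b c) s1 t2 s2"
        "t2 \<le> (1 + bcost b + ?B) * \<mu> s1 + (1 + bcost b)" "Q s2"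
        using less.hyps[OF 1(4,3)] by blast
      have "(1 + bcost b + ?B) * Suc (\<mu> s1) \<le> (1 + bcost b + ?B) * \<mu> s"
        using 1(4) by (intro mult_le_mono2) simp
      then have "1 + bcost b + t1 + t2 \<le> (1 + bcost b + ?B) * \<mu> s + (1 + bcost b)"
        unfolding mult_Suc_right using 1(2) 2(2) by linarith
      then show ?thesis using exec.WhileTrue[OF True 1(1) 2(1)] 2(3) by blast
    qed
  qed
  then obtain t s' where t: "exec (While b c) s t s'"
    "t \<le> (1 + bcost b + ?B) * \<mu> s + (1 + bcost b)" "Q s'" by blast
  let ?j = "loop_depth c"
  have pos: "1 \<le> n ^ ?j" "1 \<le> n ^ Suc ?j" using n by simp_all
  have "1 + bcost b + ?B \<le> (1 + bcost b + time_factor c) * n ^ ?j"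
    using mult_le_mono2[OF pos(1), of "1 + bcost b"] by (simp add: add_mult_distrib)
  then have "(1 + bcost b + ?B) * \<mu> s \<le> (1 + bcost b + time_factor c) * n ^ ?j * (3 * n)"
    using short by (rule mult_le_mono)
  also have "\<dots> = (1 + bcost b + time_factor c) * 3 * n ^ Suc ?j" by (simp add: algebra_simps)
  finally have "t \<le> time_factor (While b c) * n ^ loop_depth (While b c)"
    using t(2) mult_le_mono2[OF pos(2), of "1 + bcost b"]
    unfolding time_factor.simps loop_depth.simps add_mult_distrib by linarith
  then show ?thesis using t(1,3) unfolding timed_def by blast
qed

section \<open>Loop-free code\<close>

text \<open>Lets the simplifier execute straight-line code. The equation for \<open>While\<close> is
  a mere default: the connection to \<open>exec\<close> is made for loop depth 0.\<close>

primrec run :: "com \<Rightarrow> state \<Rightarrow> state" where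
  "run Skip s = s"
| "run (IAssign x es e) s = iupd x (map (ival s) es) (ival s e) s"
| "run (RAssign x es e) s = rupd x (map (ival s) es) (rval s e) s"
| "run (Seq c1 c2) s = run c2 (run c1 s)"
| "run (If b c1 c2) s = (if bval s b then run c1 s else run c2 s)"
| "run (While b c) s = s"

lemma exec_run:
  "loop_depth c = 0 \<Longrightarrow> \<exists>t. exec c s t (run c s) \<and> t \<le> time_factor c"
proof (induction c arbitrary: s)
  case Skip
  then show ?case using exec.Skip by auto
next
  case (IAssign x es e)
  then show ?case using exec.IAssign by fastforce
next
  case (RAssign x es e)
  then show ?case using exec.RAssign by fastforce
next
  case (Seq c1 c2)
  then have "loop_depth c1 = 0" "loop_depth c2 = 0" by simp_all
  then obtain t1 t2 where 1: "exec c1 s t1 (run c1 s)" "t1 \<le> time_factor c1"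
    and 2: "exec c2 (run c1 s) t2 (run c2 (run c1 s))" "t2 \<le> time_factor c2"
    using Seq.IH by meson
  show ?case using exec.Seq[OF 1(1) 2(1)] 1(2) 2(2) by (intro exI[of _ "t1 + t2"]) simp
next
  case (If b c1 c2)
  then have "loop_depth c1 = 0" "loop_depth c2 = 0" by simp_all
  then obtain t1 t2 where 1: "exec c1 s t1 (run c1 s)" "t1 \<le> time_factor c1"
    and 2: "exec c2 s t2 (run c2 s)" "t2 \<le> time_factor c2"
    using If.IH by meson
  show ?case
  proof (cases "bval s b")
    case True
    then show ?thesis using exec.IfTrue[OF True 1(1), of c2] 1(2) by (intro exI conjI) auto
  next
    case False
    then show ?thesis using exec.IfFalse[OF False 2(1), of c1] 2(2) by (intro exI conjI) auto
  qed
next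
  case (While b c)
  then show ?case by simp
qed

lemma timed_run: "loop_depth c = 0 \<Longrightarrow> Q (run c s) \<Longrightarrow> timed n c s Q"
  using exec_run[of c s] by (force simp: timed_def)


section \<open>The program\<close>

abbreviation scalar :: "string \<Rightarrow> iexp" where
  "scalar x \<equiv> IVar x []"

abbreviation assign :: "string \<Rightarrow> iexp \<Rightarrow> com" where
  "assign x \<equiv> IAssign x []"

abbreviation va :: iexp where "va \<equiv> scalar ''a''"
abbreviation vb :: iexp where "vb \<equiv> scalar ''b''"
abbreviation vd :: iexp where "vd \<equiv> scalar ''d''"
abbreviation vk :: iexp where "vk \<equiv> scalar ''k''"
abbreviation next_node :: iexp where "next_node \<equiv> IAdd vk (IConst 1)"

text \<open>\<open>F[a,b,d]\<close> and \<open>V[a,b,d]\<close> hold feasibility and value of the completions from the end nodes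
  \<open>a\<close>, \<open>b\<close> with size difference \<open>d\<close>; array indices may be negative.\<close>

definition first_flag :: iexp where
  "first_flag = IVar ''F'' [next_node, vb, IAdd vd (IConst 1)]"

definition first_value :: rexp where
  "first_value = RAdd (RVar ''C'' [va, next_node]) (RVar ''V'' [next_node, vb, IAdd vd (IConst 1)])"

definition second_flag :: iexp where
  "second_flag = IVar ''F'' [va, next_node, ISub vd (IConst 1)]"

definition second_value :: rexp where
  "second_value = RAdd (RVar ''C'' [vb, next_node]) (RVar ''V'' [va, next_node, ISub vd (IConst 1)])"

definition first_better :: bexp where
  "first_better = BAnd (ILess (IConst 0) first_flag)
     (BNot (BAnd (ILess (IConst 0) second_flag) (RLess second_value first_value)))"

definition fixed_next :: bexp where
  "fixed_next = ILess (IConst 0) (IVar ''S'' [next_node])"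

text \<open>The value is written first: integer expressions never read real memory, so the flag
  \<open>f\<close> still evaluates as in the old state.\<close>

definition set_cell :: "iexp \<Rightarrow> rexp \<Rightarrow> com" where
  "set_cell f v = Seq (RAssign ''V'' [va, vb, vd] v) (IAssign ''F'' [va, vb, vd] f)"

text \<open>The test on \<open>p\<close> expresses |d| \<le> p by two comparisons. An infeasible
  cell needs some real to store, and without real constants \<open>C[a,1]\<close> serves as a dummy
  masked by the flag 0.\<close>

definition fill_cell :: com where
  "fill_cell =
     If (ILess vk (scalar ''n''))
       (If fixed_next
         (set_cell (IVar ''F'' [next_node, next_node, vd])
           (RAdd (RAdd (RVar ''C'' [va, next_node]) (RVar ''C'' [vb, next_node]))
             (RVar ''V'' [next_node, next_node, vd])))
         (If first_better (set_cell first_flag first_value) (set_cell second_flag second_value)))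
       (If (BAnd (BNot (ILess (scalar ''p'') vd)) (BNot (ILess (IAdd (scalar ''p'') vd) (IConst 0))))
         (set_cell (IConst 1) (RAdd (RVar ''C'' [va, IConst 1]) (RVar ''C'' [vb, IConst 1])))
         (set_cell (IConst 0) (RVar ''C'' [va, IConst 1])))"

definition fill_cells :: com where
  "fill_cells = While (BNot (ILess vk vd)) (Seq fill_cell (assign ''d'' (IAdd vd (IConst 1))))"

definition start_cells :: com where
  "start_cells = Seq (If (ILess va vb) (assign ''k'' vb) (assign ''k'' va)) (assign ''d'' (ISub (IConst 0) vk))"

definition fill_row :: com where
  "fill_row = While (ILess (IConst 0) vb)
     (Seq start_cells (Seq fill_cells (assign ''b'' (ISub vb (IConst 1)))))"

definition fill_table :: com where
  "fill_table = Seq (assign ''a'' (scalar ''n''))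
     (While (ILess (IConst 0) va)
       (Seq (assign ''b'' (scalar ''n'')) (Seq fill_row (assign ''a'' (ISub va (IConst 1))))))"

definition append_node :: "string \<Rightarrow> string \<Rightarrow> iexp \<Rightarrow> com" where
  "append_node len x e =
     Seq (assign len (IAdd (scalar len) (IConst 1))) (IAssign x [scalar len] e)"

definition start_tours :: com where
  "start_tours = Seq
     (Seq (Seq (assign ''len1'' (IConst 1)) (IAssign ''tour1'' [IConst 1] (IConst 1)))
       (Seq (assign ''len2'' (IConst 1)) (IAssign ''tour2'' [IConst 1] (IConst 1))))
     (Seq (Seq (assign ''a'' (IConst 1)) (assign ''b'' (IConst 1)))
       (Seq (assign ''d'' (IConst 0)) (assign ''k'' (IConst 1))))"

definition extend_tours :: com where
  "extend_tours = Seq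
     (If fixed_next
       (Seq (Seq (append_node ''len1'' ''tour1'' next_node) (append_node ''len2'' ''tour2'' next_node))
         (Seq (assign ''a'' next_node) (assign ''b'' next_node)))
       (If first_better
         (Seq (append_node ''len1'' ''tour1'' next_node)
           (Seq (assign ''a'' next_node) (assign ''d'' (IAdd vd (IConst 1)))))
         (Seq (append_node ''len2'' ''tour2'' next_node)
           (Seq (assign ''b'' next_node) (assign ''d'' (ISub vd (IConst 1)))))))
     (assign ''k'' next_node)"

definition build_tours :: com where
  "build_tours = Seq start_tours (While (ILess vk (scalar ''n'')) extend_tours)"

definition program :: com where
  "program = Seq fill_table
     (Seq (assign ''found'' (IVar ''F'' [IConst 1, IConst 1, IConst 0]))
       (If (ILess (IConst 0) (scalar ''found'')) build_tours Skip))"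

lemmas program_defs = program_def build_tours_def extend_tours_def start_tours_def append_node_def
  fill_table_def fill_row_def start_cells_def fill_cells_def fill_cell_def set_cell_def


section \<open>Correctness of the program\<close>

declare upt_Suc [simp del]

lemma upd_simps [simp]:
  "imem (iupd x is v s) y js = (if y = x \<and> js = is then v else imem s y js)"
  "rmem (iupd x is v s) = rmem s"
  "rmem (rupd x is w s) y js = (if y = x \<and> js = is then w else rmem s y js)"
  "imem (rupd x is w s) = imem s"
  by (auto simp: iupd_def rupd_def)

definition has_input ::
  "(nat \<Rightarrow> nat \<Rightarrow> real) \<Rightarrow> nat set \<Rightarrow> nat \<Rightarrow> nat \<Rightarrow> state \<Rightarrow> bool" where
  "has_input C S p n s \<longleftrightarrow> imem s ''n'' [] = int n \<and> imem s ''p'' [] = int p \<and>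
     (\<forall>i. imem s ''S'' [int i] = of_bool (i \<in> S)) \<and>
     (\<forall>i\<in>{1..n}. \<forall>j\<in>{1..n}. rmem s ''C'' [int i, int j] = C i j)"

definition stores :: "state \<Rightarrow> int list \<Rightarrow> real option \<Rightarrow> bool" where
  "stores s is r \<longleftrightarrow> (case r of None \<Rightarrow> imem s ''F'' is = 0
     | Some v \<Rightarrow> imem s ''F'' is = 1 \<and> rmem s ''V'' is = v)"

definition denotes :: "state \<Rightarrow> iexp \<Rightarrow> rexp \<Rightarrow> real option \<Rightarrow> bool" where
  "denotes s f v r \<longleftrightarrow> (case r of None \<Rightarrow> ival s f = 0 | Some w \<Rightarrow> ival s f = 1 \<and> rval s v = w)"

text \<open>\<open>P\<close> selects the cells whose turn has passed, so the invariants of all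
  phases differ only in \<open>P\<close>.\<close>

definition filled ::
  "(nat \<Rightarrow> nat \<Rightarrow> real) \<Rightarrow> nat set \<Rightarrow> nat \<Rightarrow> nat \<Rightarrow> (nat \<Rightarrow> nat \<Rightarrow> int \<Rightarrow> bool) \<Rightarrow> state \<Rightarrow> bool" where
  "filled C S p n P s \<longleftrightarrow> has_input C S p n s \<and>
     (\<forall>a\<in>{1..n}. \<forall>b\<in>{1..n}. \<forall>d. \<bar>d\<bar> \<le> int (max a b) \<and> P a b d \<longrightarrow>
        stores s [int a, int b, d] (completion C S p [Suc (max a b)..<Suc n] a b d))"

definition position :: "nat \<Rightarrow> nat \<Rightarrow> nat \<Rightarrow> int \<Rightarrow> state \<Rightarrow> bool" where
  "position k a b d s \<longleftrightarrow> imem s ''k'' [] = int k \<and> imem s ''a'' [] = int a \<and>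
     imem s ''b'' [] = int b \<and> imem s ''d'' [] = d"

lemma has_input_upd [simp]:
  "x \<notin> {''n'', ''p'', ''S''} \<Longrightarrow> has_input C S p n (iupd x is v s) = has_input C S p n s"
  "x \<noteq> ''C'' \<Longrightarrow> has_input C S p n (rupd x is w s) = has_input C S p n s"
  by (auto simp: has_input_def)

lemma has_inputD:
  "has_input C S p n s \<Longrightarrow> i \<in> {1..n} \<Longrightarrow> j \<in> {1..n} \<Longrightarrow> rmem s ''C'' [int i, int j] = C i j"
  by (simp add: has_input_def)

lemma filledD:
  "filled C S p n P s \<Longrightarrow> a \<in> {1..n} \<Longrightarrow> b \<in> {1..n} \<Longrightarrow> k = max a b \<Longrightarrow> \<bar>d\<bar> \<le> int k \<Longrightarrow> P a b d \<Longrightarrow>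
   stores s [int a, int b, d] (completion C S p [Suc k..<Suc n] a b d)"
  by (simp add: filled_def)

lemma stores_iupd [simp]: "x \<noteq> ''F'' \<Longrightarrow> stores (iupd x is v s) js r = stores s js r"
  by (auto simp: stores_def split: option.split)

lemma filled_iupd [simp]:
  "x \<notin> {''n'', ''p'', ''S'', ''F''} \<Longrightarrow> filled C S p n P (iupd x is v s) = filled C S p n P s"
  by (simp add: filled_def)

lemma filled_mono:
  "filled C S p n P s \<Longrightarrow>
   (\<And>a b d. a \<in> {1..n} \<Longrightarrow> b \<in> {1..n} \<Longrightarrow> \<bar>d\<bar> \<le> int (max a b) \<Longrightarrow> Q a b d \<Longrightarrow> P a b d) \<Longrightarrow>
   filled C S p n Q s"
  unfolding filled_def by blast

section \<open>Filling the table backwards\<close>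

lemma bval_fixed_next:
  "has_input C S p n s \<Longrightarrow> position k a b d s \<Longrightarrow> bval s fixed_next \<longleftrightarrow> Suc k \<in> S"
  unfolding has_input_def position_def fixed_next_def
  by (auto dest: spec[of _ "Suc k"] simp: add.commute)

text \<open>Serves both phases: while filling, \<open>P\<close> is the part of the table computed so
  far; while building tours, it is always true. Hence the forward phase decides exactly as the
  recursion did.\<close>

lemma bval_first_better:
  assumes f: "filled C S p n P s" and pos: "position k a b d s" and k: "k = max a b" "k < n"
    and ab: "a \<in> {1..n}" "b \<in> {1..n}" and d: "\<bar>d\<bar> \<le> int k"
    and P: "P (Suc k) b (d + 1)" "P a (Suc k) (d - 1)"
  defines "u \<equiv> map_option ((+) (C a (Suc k))) (completion C S p [Suc (Suc k)..<Suc n] (Suc k) b (d + 1))"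
    and "v \<equiv> map_option ((+) (C b (Suc k))) (completion C S p [Suc (Suc k)..<Suc n] a (Suc k) (d - 1))"
  shows "bval s first_better \<longleftrightarrow> prefers_first u v"
    and "denotes s first_flag first_value u" and "denotes s second_flag second_value v"
proof -
  have inp: "has_input C S p n s" using f by (simp add: filled_def)
  have k': "Suc k \<in> {1..n}" using k(2) by simp
  have "stores s [int (Suc k), int b, d + 1]
      (completion C S p [Suc (Suc k)..<Suc n] (Suc k) b (d + 1))"
    using k d by (intro filledD[OF f k' ab(2) _ _ P(1)]) auto
  moreover note has_inputD[OF inp ab(1) k']
  ultimately show 1: "denotes s first_flag first_value u"
    using pos unfolding u_def first_flag_def first_value_def position_def
    by (auto simp: stores_def denotes_def add.commute split: option.splits)
  have "stores s [int a, int (Suc k), d - 1]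
      (completion C S p [Suc (Suc k)..<Suc n] a (Suc k) (d - 1))"
    using k d by (intro filledD[OF f ab(1) k' _ _ P(2)]) auto
  moreover note has_inputD[OF inp ab(2) k']
  ultimately show 2: "denotes s second_flag second_value v"
    using pos unfolding v_def second_flag_def second_value_def position_def
    by (auto simp: stores_def denotes_def add.commute split: option.splits)
  show "bval s first_better \<longleftrightarrow> prefers_first u v"
    using 1 2 unfolding first_better_def prefers_first_def
    by (cases u; cases v) (auto simp: denotes_def)
qed

lemma ival_rupd [simp]: "ival (rupd x is w s) e = ival s e"
proof (induction e)
  case (IVar y es)
  then have eq: "map (ival (rupd x is w s)) es = map (ival s) es" by (intro map_cong) auto
  show ?case by (simp only: ival.simps upd_simps eq)
qed simp_all

lemma run_set_cell:
  assumes "position k a b d s" and "denotes s f v r"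
  shows "\<exists>i w. run (set_cell f v) s = iupd ''F'' [int a, int b, d] i (rupd ''V'' [int a, int b, d] w s) \<and>
    stores (run (set_cell f v) s) [int a, int b, d] r"
  using assms
  by (intro exI[of _ "ival s f"] exI[of _ "rval s v"])
    (auto simp: set_cell_def position_def stores_def denotes_def split: option.split)

text \<open>The cells computed before the loops reach \<open>(a, b, d)\<close>: \<open>a\<close> and
  \<open>b\<close> run downwards but \<open>d\<close> runs upwards, which explains the reversed last
  comparison.\<close>

definition later :: "nat \<Rightarrow> nat \<Rightarrow> int \<Rightarrow> nat \<Rightarrow> nat \<Rightarrow> int \<Rightarrow> bool" where
  "later a b d a' b' d' \<longleftrightarrow> a < a' \<or> a = a' \<and> (b < b' \<or> b = b' \<and> d' < d)"

lemma run_fill_cell: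
  assumes f: "filled C S p n (later a b d) s" and pos: "position k a b d s" and k: "k = max a b"
    and ab: "a \<in> {1..n}" "b \<in> {1..n}" and d: "\<bar>d\<bar> \<le> int k"
  shows "\<exists>i w. run fill_cell s = iupd ''F'' [int a, int b, d] i (rupd ''V'' [int a, int b, d] w s) \<and>
    stores (run fill_cell s) [int a, int b, d] (completion C S p [Suc k..<Suc n] a b d)"
proof -
  have inp: "has_input C S p n s" using f by (simp add: filled_def)
  have n: "imem s ''n'' [] = int n" "imem s ''p'' [] = int p" using inp by (simp_all add: has_input_def)
  note pos' = pos[unfolded position_def]
  show ?thesis
  proof (cases "k < n")
    case False
    then have "n = k" using k ab by auto
    have C1: "rmem s ''C'' [int a, 1] = C a 1" "rmem s ''C'' [int b, 1] = C b 1"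
      using has_inputD[OF inp ab(1), of 1] has_inputD[OF inp ab(2), of 1] ab by simp_all
    show ?thesis
    proof (cases "\<bar>d\<bar> \<le> int p")
      case True
      then have eq: "run fill_cell s =
          run (set_cell (IConst 1) (RAdd (RVar ''C'' [va, IConst 1]) (RVar ''C'' [vb, IConst 1]))) s"
        using \<open>n = k\<close> pos' n by (simp add: fill_cell_def)
      show ?thesis unfolding eq using True \<open>n = k\<close> pos' C1
        by (intro run_set_cell[OF pos]) (simp add: denotes_def)
    next
      case False
      then have eq: "run fill_cell s = run (set_cell (IConst 0) (RVar ''C'' [va, IConst 1])) s"
        using \<open>n = k\<close> pos' n by (auto simp: fill_cell_def)
      show ?thesis unfolding eq using False \<open>n = k\<close>
        by (intro run_set_cell[OF pos]) (simp add: denotes_def)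
    qed
  next
    case True
    have upt: "[Suc k..<Suc n] = Suc k # [Suc (Suc k)..<Suc n]" using True by (simp add: upt_conv_Cons)
    note P = bval_first_better[OF f pos k True ab d]
    \<comment> \<open>As \<open>k = max a b\<close>, each successor has a larger first index, or the
      same first and a larger second index; the difference never matters.\<close>
    have P1: "later a b d (Suc k) b (d + 1)" "later a b d a (Suc k) (d - 1)" "later a b d (Suc k) (Suc k) d"
      using k by (auto simp: later_def)
    note P = P[OF P1(1,2)]
    show ?thesis
    proof (cases "Suc k \<in> S")
      case S: True
      have k': "Suc k \<in> {1..n}" using True by simp
      have "stores s [int (Suc k), int (Suc k), d] (completion C S p [Suc (Suc k)..<Suc n] (Suc k) (Suc k) d)"
        using d by (intro filledD[OF f k' k' _ _ P1(3)]) auto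
      moreover note has_inputD[OF inp ab(1) k'] has_inputD[OF inp ab(2) k']
      moreover have eq: "run fill_cell s = run (set_cell (IVar ''F'' [next_node, next_node, vd])
           (RAdd (RAdd (RVar ''C'' [va, next_node]) (RVar ''C'' [vb, next_node]))
             (RVar ''V'' [next_node, next_node, vd]))) s"
        using True pos' n S bval_fixed_next[OF inp pos] by (simp add: fill_cell_def)
      ultimately show ?thesis unfolding eq upt using S pos'
        by (intro run_set_cell[OF pos]) (auto simp: denotes_def stores_def add.commute split: option.splits)
    next
      case S: False
      show ?thesis
      proof (cases "bval s first_better")
        case better: True
        then have eq: "run fill_cell s = run (set_cell first_flag first_value) s"
          using True pos' n S bval_fixed_next[OF inp pos] by (simp add: fill_cell_def)
        show ?thesis unfolding eq upt using P better S
          by (intro run_set_cell[OF pos]) (simp add: Let_def)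
      next
        case better: False
        then have eq: "run fill_cell s = run (set_cell second_flag second_value) s"
          using True pos' n S bval_fixed_next[OF inp pos] by (simp add: fill_cell_def)
        show ?thesis unfolding eq upt using P better S
          by (intro run_set_cell[OF pos]) (simp add: Let_def)
      qed
    qed
  qed
qed

text \<open>Raising \<open>d\<close> by one adds just the cell now written to the selected ones, and
  all others are untouched.\<close>

lemma fill_cell_filled:
  assumes f: "filled C S p n (later a b d) s" and pos: "position k a b d s" and k: "k = max a b"
    and ab: "a \<in> {1..n}" "b \<in> {1..n}" and d: "\<bar>d\<bar> \<le> int k"
  shows "filled C S p n (later a b (d + 1)) (run fill_cell s)" "position k a b d (run fill_cell s)"
proof -
  let ?s = "run fill_cell s"
  obtain i w where eq: "?s = iupd ''F'' [int a, int b, d] i (rupd ''V'' [int a, int b, d] w s)"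
    and st: "stores ?s [int a, int b, d] (completion C S p [Suc k..<Suc n] a b d)"
    using run_fill_cell[OF assms] by blast
  show "position k a b d ?s" using pos unfolding eq by (simp add: position_def)
  have other: "stores ?s js r = stores s js r" if "js \<noteq> [int a, int b, d]" for js r
    using that unfolding eq stores_def by (cases r) auto
  have "stores ?s [int a', int b', d'] (completion C S p [Suc (max a' b')..<Suc n] a' b' d')"
    if "a' \<in> {1..n}" "b' \<in> {1..n}" "\<bar>d'\<bar> \<le> int (max a' b')" "later a b (d + 1) a' b' d'" for a' b' d'
  proof (cases "a' = a \<and> b' = b \<and> d' = d")
    case True
    then show ?thesis using st k by simp
  next
    case False
    then have "later a b d a' b' d'" using that(4) by (auto simp: later_def)
    then show ?thesis using f that(1-3) False by (subst other) (auto simp: filled_def)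
  qed
  moreover have "has_input C S p n ?s" using f unfolding eq by (simp add: filled_def)
  ultimately show "filled C S p n (later a b (d + 1)) ?s" by (simp add: filled_def)
qed

lemma fill_cells_timed:
  assumes f: "filled C S p n (later a b (- int k)) s" and pos: "position k a b (- int k) s"
    and k: "k = max a b" and ab: "a \<in> {1..n}" "b \<in> {1..n}"
  shows "timed n fill_cells s (\<lambda>s. filled C S p n (later a b (int k + 1)) s \<and> position k a b (int k + 1) s)"
  unfolding fill_cells_def
proof (rule timed_While[where \<mu> = "\<lambda>s. nat (int k + 1 - imem s ''d'' [])" and
      I = "\<lambda>s. \<exists>d. \<bar>d\<bar> \<le> int k + 1 \<and> - int k \<le> d \<and> filled C S p n (later a b d) s \<and> position k a b d s"])
  show n: "1 \<le> n" using ab by simp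
  show "\<exists>d. \<bar>d\<bar> \<le> int k + 1 \<and> - int k \<le> d \<and> filled C S p n (later a b d) s \<and> position k a b d s"
    using f pos by (intro exI[of _ "- int k"]) simp
  \<comment> \<open>Initially the measure is \<open>2 * k + 1\<close>, which is at most
    \<open>3 * n\<close> because \<open>k \<le> n\<close> and \<open>1 \<le> n\<close>.\<close>
  have "k \<le> n" using k ab by simp
  then show "nat (int k + 1 - imem s ''d'' []) \<le> 3 * n" using pos n by (simp add: position_def)
next
  fix s
  assume "\<exists>d. \<bar>d\<bar> \<le> int k + 1 \<and> - int k \<le> d \<and> filled C S p n (later a b d) s \<and> position k a b d s"
    and b: "bval s (BNot (ILess vk vd))"
  then obtain d where d: "- int k \<le> d" "filled C S p n (later a b d) s" "position k a b d s" by blast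
  then have dk: "d \<le> int k" using b by (simp add: position_def)
  with d have "\<bar>d\<bar> \<le> int k" by simp
  note cell = fill_cell_filled[OF d(2,3) k ab this]
  show "timed n (Seq fill_cell (assign ''d'' (IAdd vd (IConst 1)))) s
      (\<lambda>s'. (\<exists>d. \<bar>d\<bar> \<le> int k + 1 \<and> - int k \<le> d \<and> filled C S p n (later a b d) s' \<and> position k a b d s') \<and>
        nat (int k + 1 - imem s' ''d'' []) < nat (int k + 1 - imem s ''d'' []))"
  proof (rule timed_run)
    show "loop_depth (Seq fill_cell (assign ''d'' (IAdd vd (IConst 1)))) = 0"
      by (simp add: program_defs)
    show "(\<exists>d. \<bar>d\<bar> \<le> int k + 1 \<and> - int k \<le> d \<and>
          filled C S p n (later a b d) (run (Seq fill_cell (assign ''d'' (IAdd vd (IConst 1)))) s) \<and>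
          position k a b d (run (Seq fill_cell (assign ''d'' (IAdd vd (IConst 1)))) s)) \<and>
        nat (int k + 1 - imem (run (Seq fill_cell (assign ''d'' (IAdd vd (IConst 1)))) s) ''d'' []) <
        nat (int k + 1 - imem s ''d'' [])"
      using cell d(1,3) dk by (intro conjI exI[of _ "d + 1"]) (auto simp: position_def)
  qed
next
  fix s
  assume "\<exists>d. \<bar>d\<bar> \<le> int k + 1 \<and> - int k \<le> d \<and> filled C S p n (later a b d) s \<and> position k a b d s"
    and "\<not> bval s (BNot (ILess vk vd))"
  then obtain d where d: "\<bar>d\<bar> \<le> int k + 1" "filled C S p n (later a b d) s" "position k a b d s"
    "int k < d" by (auto simp: position_def)
  then have "d = int k + 1" by simp
  then show "filled C S p n (later a b (int k + 1)) s \<and> position k a b (int k + 1) s"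
    using d by simp
qed

text \<open>Setting \<open>d = - n\<close> makes the last case of \<^const>\<open>later\<close> void.\<close>

lemma fill_row_timed:
  assumes f: "filled C S p n (later a n (- int n)) s" and s: "imem s ''a'' [] = int a" "imem s ''b'' [] = int n"
    and a: "a \<in> {1..n}"
  shows "timed n fill_row s (\<lambda>s. filled C S p n (later a 0 (- int n)) s \<and> imem s ''a'' [] = int a)"
  unfolding fill_row_def
proof (rule timed_While[where \<mu> = "\<lambda>s. nat (imem s ''b'' [])" and
      I = "\<lambda>s. \<exists>b\<le>n. filled C S p n (later a b (- int n)) s \<and> imem s ''a'' [] = int a \<and> imem s ''b'' [] = int b"])
  show n: "1 \<le> n" using a by simp
  show "\<exists>b\<le>n. filled C S p n (later a b (- int n)) s \<and> imem s ''a'' [] = int a \<and> imem s ''b'' [] = int b"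
    using f s by auto
  show "nat (imem s ''b'' []) \<le> 3 * n" using s by simp
next
  fix s
  assume "\<exists>b\<le>n. filled C S p n (later a b (- int n)) s \<and> imem s ''a'' [] = int a \<and> imem s ''b'' [] = int b"
    and "bval s (ILess (IConst 0) vb)"
  then obtain b where b: "b \<in> {1..n}" "filled C S p n (later a b (- int n)) s"
    "imem s ''a'' [] = int a" "imem s ''b'' [] = int b" by force
  let ?k = "max a b"
  \<comment> \<open>No cell with end nodes \<open>a\<close>, \<open>b\<close> has a difference below
    \<open>- max a b\<close>, so starting at \<open>- n\<close> or at \<open>- max a b\<close>
    selects the same cells.\<close>
  have f: "filled C S p n (later a b (- int ?k)) s"
    using b(2) by (rule filled_mono) (auto simp: later_def)
  let ?s = "run start_cells s"
  have 1: "filled C S p n (later a b (- int ?k)) ?s" "position ?k a b (- int ?k) ?s"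
    using f b by (auto simp: start_cells_def position_def)
  show "timed n (Seq start_cells (Seq fill_cells (assign ''b'' (ISub vb (IConst 1))))) s
      (\<lambda>s'. (\<exists>b\<le>n. filled C S p n (later a b (- int n)) s' \<and> imem s' ''a'' [] = int a \<and> imem s' ''b'' [] = int b) \<and>
        nat (imem s' ''b'' []) < nat (imem s ''b'' []))"
  proof (rule timed_Seq)
    show n: "1 \<le> n" using a by simp
    show "timed n start_cells s (\<lambda>s'. timed n (Seq fill_cells (assign ''b'' (ISub vb (IConst 1)))) s'
      (\<lambda>s'. (\<exists>b\<le>n. filled C S p n (later a b (- int n)) s' \<and> imem s' ''a'' [] = int a \<and> imem s' ''b'' [] = int b) \<and>
        nat (imem s' ''b'' []) < nat (imem s ''b'' [])))"
    proof (rule timed_run, simp add: program_defs, rule timed_Seq[OF n],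
        rule timed_mono[OF fill_cells_timed[OF 1 refl a b(1)]], rule timed_run, simp)
      fix s'
      assume s': "filled C S p n (later a b (int ?k + 1)) s' \<and> position ?k a b (int ?k + 1) s'"
      have "filled C S p n (later a (b - 1) (- int n)) s'"
        using conjunct1[OF s'] by (rule filled_mono) (use b(1) in \<open>auto simp: later_def\<close>)
      then show "(\<exists>b\<le>n. filled C S p n (later a b (- int n)) (run (assign ''b'' (ISub vb (IConst 1))) s') \<and>
          imem (run (assign ''b'' (ISub vb (IConst 1))) s') ''a'' [] = int a \<and>
          imem (run (assign ''b'' (ISub vb (IConst 1))) s') ''b'' [] = int b) \<and>
        nat (imem (run (assign ''b'' (ISub vb (IConst 1))) s') ''b'' []) < nat (imem s ''b'' [])"
        using s' b(1,4) by (intro conjI exI[of _ "b - 1"]) (auto simp: position_def)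
    qed
  qed
next
  fix s
  assume "\<exists>b\<le>n. filled C S p n (later a b (- int n)) s \<and> imem s ''a'' [] = int a \<and> imem s ''b'' [] = int b"
    and "\<not> bval s (ILess (IConst 0) vb)"
  then show "filled C S p n (later a 0 (- int n)) s \<and> imem s ''a'' [] = int a" by auto
qed

text \<open>With second index \<open>n\<close> and difference \<open>- n\<close>,
  \<open>later\<close> selects nothing with first index \<open>a\<close>, so
  \<open>later a n (- int n)\<close> says that exactly the first indices above \<open>a\<close> are
  done: none for \<open>a = n\<close>, all for \<open>a = 0\<close>.\<close>

lemma fill_table_timed:
  assumes inp: "has_input C S p n s" and n: "1 \<le> n"
  shows "timed n fill_table s (filled C S p n (\<lambda>a b d. True))"
  unfolding fill_table_def
proof (rule timed_Seq[OF n], rule timed_run, simp, rule timed_While[where \<mu> = "\<lambda>s. nat (imem s ''a'' [])" and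
      I = "\<lambda>s. \<exists>a\<le>n. filled C S p n (later a n (- int n)) s \<and> imem s ''a'' [] = int a"])
  show "1 \<le> n" by (rule n)
  let ?s = "run (assign ''a'' (scalar ''n'')) s"
  have a: "imem ?s ''a'' [] = int n" using inp by (simp add: has_input_def)
  moreover have "filled C S p n (later n n (- int n)) ?s"
    using inp by (auto simp: filled_def later_def)
  ultimately show "\<exists>a\<le>n. filled C S p n (later a n (- int n)) ?s \<and> imem ?s ''a'' [] = int a" by blast
  show "nat (imem ?s ''a'' []) \<le> 3 * n" using a by simp
next
  fix s :: state
  let ?inv = "\<lambda>s'. (\<exists>a\<le>n. filled C S p n (later a n (- int n)) s' \<and> imem s' ''a'' [] = int a) \<and>
    nat (imem s' ''a'' []) < nat (imem s ''a'' [])"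
  assume "\<exists>a\<le>n. filled C S p n (later a n (- int n)) s \<and> imem s ''a'' [] = int a"
    and "bval s (ILess (IConst 0) va)"
  then obtain a where a: "a \<in> {1..n}" "filled C S p n (later a n (- int n)) s" "imem s ''a'' [] = int a"
    by force
  have 1: "filled C S p n (later (a - 1) n (- int n)) s'"
    if "filled C S p n (later a 0 (- int n)) s'" for s'
    using that by (rule filled_mono) (use a(1) in \<open>auto simp: later_def\<close>)
  have 2: "filled C S p n (later a n (- int n)) (run (assign ''b'' (scalar ''n'')) s)"
    "imem (run (assign ''b'' (scalar ''n'')) s) ''a'' [] = int a"
    "imem (run (assign ''b'' (scalar ''n'')) s) ''b'' [] = int n"
    using a by (auto simp: filled_def has_input_def)
  have 3: "?inv (run (assign ''a'' (ISub va (IConst 1))) s')"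
    if "filled C S p n (later a 0 (- int n)) s' \<and> imem s' ''a'' [] = int a" for s'
    using that 1 a(1,3) by (intro conjI exI[of _ "a - 1"]) auto
  show "timed n (Seq (assign ''b'' (scalar ''n'')) (Seq fill_row (assign ''a'' (ISub va (IConst 1))))) s ?inv"
    by (rule timed_Seq[OF n], rule timed_run, simp, rule timed_Seq[OF n],
        rule timed_mono[OF fill_row_timed[OF 2 a(1)]], rule timed_run, simp, rule 3)
next
  fix s :: state
  assume "\<exists>a\<le>n. filled C S p n (later a n (- int n)) s \<and> imem s ''a'' [] = int a"
    and "\<not> bval s (ILess (IConst 0) va)"
  then have "filled C S p n (later 0 n (- int n)) s" by auto
  then show "filled C S p n (\<lambda>a b d. True) s" by (rule filled_mono) (simp add: later_def)
qed

section \<open>Building the tours forwards\<close>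

lemma output_list_iupd [simp]:
  "x \<noteq> len \<Longrightarrow> x \<noteq> y \<Longrightarrow> output_list (iupd x is v s) len y = output_list s len y"
  by (simp add: output_list_def)

lemma output_list_append:
  assumes "imem s len [] = m" "0 \<le> m" "x \<noteq> len"
  shows "output_list (iupd x [m + 1] v (iupd len [] (m + 1) s)) len x = output_list s len x @ [nat v]"
proof -
  have "nat (m + 1) = Suc (nat m)" using assms by simp
  then show ?thesis using assms by (auto simp: output_list_def upt_Suc)
qed

text \<open>Nonnegative lengths are demanded because \<open>output_list\<close> reads them through
  \<open>nat\<close>; incrementing a negative length would not append a node.\<close>

definition partial_output ::
  "(nat \<Rightarrow> nat \<Rightarrow> real) \<Rightarrow> nat set \<Rightarrow> nat \<Rightarrow> nat \<Rightarrow> real \<Rightarrow> nat \<Rightarrow> nat \<Rightarrow> nat \<Rightarrow> int \<Rightarrow> state \<Rightarrow> bool" where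
  "partial_output C S p n v k a b d s \<longleftrightarrow>
     filled C S p n (\<lambda>a b d. True) s \<and> position k a b d s \<and> k \<le> n \<and> imem s ''found'' [] = 1 \<and>
     0 \<le> imem s ''len1'' [] \<and> 0 \<le> imem s ''len2'' [] \<and>
     extends_to C S p n v k a b d (output_list s ''len1'' ''tour1'') (output_list s ''len2'' ''tour2'')"

lemma extend_tours_step:
  assumes inv: "partial_output C S p n v k a b d s" and k: "k < n"
  shows "\<exists>a' b' d'. partial_output C S p n v (Suc k) a' b' d' (run extend_tours s)"
proof -
  note I = inv[unfolded partial_output_def]
  have f: "filled C S p n (\<lambda>a b d. True) s" and pos: "position k a b d s"
    and ext: "extends_to C S p n v k a b d (output_list s ''len1'' ''tour1'') (output_list s ''len2'' ''tour2'')"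
    using I by blast+
  have inp: "has_input C S p n s" using f by (simp add: filled_def)
  note pos' = pos[unfolded position_def]
  note bounds = extends_to_bounds[OF ext]
  have ab: "a \<in> {1..n}" "b \<in> {1..n}" using bounds k by auto
  note better = bval_first_better(1)[OF f pos bounds(3) k ab bounds(4) TrueI TrueI]
  note fixed = bval_fixed_next[OF inp pos]
  have succ: "nat (int k + 1) = Suc k" by simp
  show ?thesis
  proof (cases "Suc k \<in> S")
    case True
    note new = extends_to_step(1)[OF ext k True]
    show ?thesis using new True fixed I pos' k
      by (intro exI[of _ "Suc k"] exI[of _ d])
        (simp add: partial_output_def extend_tours_def append_node_def output_list_append position_def succ)
  next
    case False
    show ?thesis
    proof (cases "bval s first_better")
      case True
      note new = extends_to_step(2)[OF ext k False iffD1[OF better True]]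
      show ?thesis using new True False fixed I pos' k
        by (intro exI[of _ "Suc k"] exI[of _ b] exI[of _ "d + 1"])
          (simp add: partial_output_def extend_tours_def append_node_def output_list_append position_def succ)
    next
      case worse: False
      note new = extends_to_step(3)[OF ext k False worse[unfolded better]]
      show ?thesis using new worse False fixed I pos' k
        by (intro exI[of _ a] exI[of _ "Suc k"] exI[of _ "d - 1"])
          (simp add: partial_output_def extend_tours_def append_node_def output_list_append position_def succ)
    qed
  qed
qed

lemma start_tours_output:
  assumes f: "filled C S p n (\<lambda>a b d. True) s" and "imem s ''found'' [] = 1" "1 \<in> S" "1 \<le> n"
    and v: "completion C S p [2..<Suc n] 1 1 0 = Some v"
  shows "partial_output C S p n v 1 1 1 0 (run start_tours s)"
  using assms extends_to_init[OF v]
  by (simp add: partial_output_def start_tours_def position_def output_list_def upt_Suc)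

lemma build_tours_timed:
  assumes f: "filled C S p n (\<lambda>a b d. True) s" and "imem s ''found'' [] = 1" "1 \<in> S" and n: "1 \<le> n"
    and v: "completion C S p [2..<Suc n] 1 1 0 = Some v"
  shows "timed n build_tours s (\<lambda>s. \<exists>a b d. partial_output C S p n v n a b d s)"
  unfolding build_tours_def
proof (rule timed_Seq[OF n], rule timed_run, simp add: program_defs, rule timed_While[where
      \<mu> = "\<lambda>s. nat (int n - imem s ''k'' [])" and
      I = "\<lambda>s. \<exists>k a b d. partial_output C S p n v k a b d s"])
  show "1 \<le> n" by (rule n)
  note start = start_tours_output[OF assms]
  then show "\<exists>k a b d. partial_output C S p n v k a b d (run start_tours s)" by blast
  show "nat (int n - imem (run start_tours s) ''k'' []) \<le> 3 * n"
    using start by (simp add: partial_output_def position_def)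
next
  fix s
  assume "\<exists>k a b d. partial_output C S p n v k a b d s" and b: "bval s (ILess vk (scalar ''n''))"
  then obtain k a b d where inv: "partial_output C S p n v k a b d s" by blast
  have k: "imem s ''k'' [] = int k" "imem s ''n'' [] = int n"
    using inv by (simp_all add: partial_output_def position_def filled_def has_input_def)
  then have "k < n" using b by simp
  then obtain a' b' d' where step: "partial_output C S p n v (Suc k) a' b' d' (run extend_tours s)"
    using extend_tours_step[OF inv] by blast
  show "timed n extend_tours s (\<lambda>s'. (\<exists>k a b d. partial_output C S p n v k a b d s') \<and>
      nat (int n - imem s' ''k'' []) < nat (int n - imem s ''k'' []))"
  proof (rule timed_run)
    show "loop_depth extend_tours = 0" by (simp add: program_defs)
    have "imem (run extend_tours s) ''k'' [] = int (Suc k)"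
      using step by (simp add: partial_output_def position_def)
    then show "(\<exists>k a b d. partial_output C S p n v k a b d (run extend_tours s)) \<and>
        nat (int n - imem (run extend_tours s) ''k'' []) < nat (int n - imem s ''k'' [])"
      using step k \<open>k < n\<close> by auto
  qed
next
  fix s
  assume "\<exists>k a b d. partial_output C S p n v k a b d s" and b: "\<not> bval s (ILess vk (scalar ''n''))"
  then obtain k a b d where inv: "partial_output C S p n v k a b d s" by blast
  have "imem s ''k'' [] = int k" "imem s ''n'' [] = int n" "k \<le> n"
    using inv by (simp_all add: partial_output_def position_def filled_def has_input_def)
  then have "k = n" using b by simp
  then show "\<exists>a b d. partial_output C S p n v n a b d s" using inv by blast
qed

text \<open>The two sides of optimality meet here: the forward invariant ends in a feasible pair of
  total length \<open>v\<close>, and \<open>feasible_completion\<close> shows that no feasible pair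
  is shorter.\<close>

lemma program_timed:
  assumes K: "kalmanson n C" and S: "S \<subseteq> {1..n}" "1 \<in> S"
  shows "timed n program (input_state n C S p) (correct_output n C S p)"
proof -
  have n: "1 \<le> n" using S by force
  have inp: "has_input C S p n (input_state n C S p)"
    by (auto simp: has_input_def input_state_def)
  let ?find = "assign ''found'' (IVar ''F'' [IConst 1, IConst 1, IConst 0])"
  have final: "timed n (If (ILess (IConst 0) (scalar ''found'')) build_tours Skip) (run ?find s)
      (correct_output n C S p)"
    if f: "filled C S p n (\<lambda>a b d. True) s" for s
  proof (cases "completion C S p [2..<Suc n] 1 1 0")
    case None
    then have none: "\<nexists>\<tau>1 \<tau>2. feasible n S p \<tau>1 \<tau>2" using feasible_completion[OF K] by fastforce
    have "imem s ''F'' [1, 1, 0] = 0"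
      using filledD[OF f, of 1 1 1 0] n None by (simp add: stores_def numeral_2_eq_2)
    with none show ?thesis by (intro timed_If[OF n] timed_run) (simp_all add: correct_output_def)
  next
    case (Some v)
    have found: "imem s ''F'' [1, 1, 0] = 1"
      using filledD[OF f, of 1 1 1 0] n Some by (simp add: stores_def numeral_2_eq_2)
    have correct: "correct_output n C S p s'" if out: "\<exists>a b d. partial_output C S p n v n a b d s'" for s'
    proof -
      let ?\<tau>1 = "output_list s' ''len1'' ''tour1''" and ?\<tau>2 = "output_list s' ''len2'' ''tour2''"
      obtain a b d where ext: "extends_to C S p n v n a b d ?\<tau>1 ?\<tau>2" and "imem s' ''found'' [] = 1"
        using out by (auto simp: partial_output_def)
      have feas: "feasible n S p ?\<tau>1 ?\<tau>2" and len: "tour_length C ?\<tau>1 + tour_length C ?\<tau>2 = v"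
        using extends_to_final[OF ext S(1)] by blast+
      have "v \<le> tour_length C \<sigma>1 + tour_length C \<sigma>2" if "feasible n S p \<sigma>1 \<sigma>2" for \<sigma>1 \<sigma>2
        using feasible_completion[OF K that] Some by simp
      then show ?thesis using feas len \<open>imem s' ''found'' [] = 1\<close>
        unfolding correct_output_def optimal_def by auto
    qed
    have "timed n build_tours (run ?find s) (correct_output n C S p)"
      using f found by (intro timed_mono[OF build_tours_timed[OF _ _ S(2) n Some] correct]) simp_all
    then show ?thesis using found by (intro timed_If[OF n]) simp_all
  qed
  show ?thesis unfolding program_def
    by (rule timed_Seq[OF n], rule timed_mono[OF fill_table_timed[OF inp n]], rule timed_Seq[OF n],
        rule timed_run, simp, rule final)
qed

theorem proposition2p1:
  "\<exists>(prog :: com) (T :: nat \<Rightarrow> nat).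
     (\<lambda>n. real (T n)) \<in> O(\<lambda>n. real n ^ 3) \<and>
     (\<forall>(n :: nat) (C :: nat \<Rightarrow> nat \<Rightarrow> real) (S :: nat set) (p :: nat).
        kalmanson n C \<and> S \<subseteq> {1..n} \<and> 1 \<in> S \<longrightarrow>
        (\<exists>t s. exec prog (input_state n C S p) t s \<and> t \<le> T n \<and> correct_output n C S p s))"
proof (intro exI[of _ program] exI[of _ "\<lambda>n. time_factor program * n ^ 3"] conjI allI impI)
  show "(\<lambda>n. real (time_factor program * n ^ 3)) \<in> O(\<lambda>n. real n ^ 3)" by simp
next
  fix n p :: nat and C :: "nat \<Rightarrow> nat \<Rightarrow> real" and S :: "nat set"
  assume "kalmanson n C \<and> S \<subseteq> {1..n} \<and> 1 \<in> S"
  then have "timed n program (input_state n C S p) (correct_output n C S p)" by (simp add: program_timed)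
  \<comment> \<open>The nested loops over \<open>a\<close>, \<open>b\<close> and \<open>d\<close>
    give the exponent; the single loop building the tours comes after them and does not raise the
    maximum.\<close>
  moreover have "loop_depth program = 3" by (simp add: program_defs)
  ultimately show "\<exists>t s. exec program (input_state n C S p) t s \<and>
      t \<le> time_factor program * n ^ 3 \<and> correct_output n C S p s"
    by (simp add: timed_def)
qed

end
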